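(* Let $k\ge 3$ and $n\ge 2$ be integers. Then $\chi_\rho(S^n_{P_k})=3$ if $k=3$ (and $n\ge 2$); $\chi_\rho(S^n_{P_k})=4$ if $k\ge4$ and $n=2$; and $\chi_\rho(S^n_{P_k})=5$ if $k\ge 4$ and $n\ge 3$.
   Context: $P_k$ is the path with vertex set $[k]=\{0,\dots,k-1\}$ and edges $\{i,i+1\}$, $0\le i\le k-2$. For a graph $G$ with vertex set $[k]$ and $n\ge 1$, the generalized Sierpi\'nski graph $S^n_G$ has vertex set $[k]^n$, and $u=u_1\cdots u_n$, $v=v_1\cdots v_n$ are adjacent iff there is $i$ with: $u_j=v_j$ for $j<i$; $u_i\neq v_i$ and $u_iv_i\in E(G)$; and $u_j=v_i$, $v_j=u_i$ for all $j>i$. A packing $c$-coloring of a graph $X$ is a map $f:V(X)\to\{1,\dots,c\}$ such that any two distinct vertices $u,v$ with $f(u)=f(v)=i$ satisfy $d_X(u,v)>i$; the packing chromatic number $\chi_\rho(X)$ is the least such $c$. *)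

theory Defs
  imports Main "HOL-Library.Extended_Nat"
begin

text \<open>Graphs on vertex type 'v are given by a vertex set V and an adjacency
relation adj (assumed symmetric and irreflexive on V where relevant).\<close>

definition path_adj :: "nat \<Rightarrow> nat \<Rightarrow> nat \<Rightarrow> bool" where
  "path_adj k a b \<longleftrightarrow> a < k \<and> b < k \<and> (b = a + 1 \<or> a = b + 1)"

text \<open>Vertex set [k]^n of the generalized Sierpinski graph, words as lists;
u!0 is the letter u_1 of the paper.\<close>
definition sier_vertices :: "nat \<Rightarrow> nat \<Rightarrow> nat list set" where
  "sier_vertices k n = {u. length u = n \<and> set u \<subseteq> {..<k}}"

definition sier_adj :: "(nat \<Rightarrow> nat \<Rightarrow> bool) \<Rightarrow> nat \<Rightarrow> nat \<Rightarrow> nat list \<Rightarrow> nat list \<Rightarrow> bool" where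
  "sier_adj E k n u v \<longleftrightarrow> u \<in> sier_vertices k n \<and> v \<in> sier_vertices k n \<and>
     (\<exists>i<n. (\<forall>j<i. u!j = v!j) \<and> u!i \<noteq> v!i \<and> E (u!i) (v!i) \<and>
            (\<forall>j. i < j \<and> j < n \<longrightarrow> u!j = v!i \<and> v!j = u!i))"

definition is_walk :: "'v set \<Rightarrow> ('v \<Rightarrow> 'v \<Rightarrow> bool) \<Rightarrow> 'v \<Rightarrow> 'v \<Rightarrow> nat \<Rightarrow> bool" where
  "is_walk V adj u v m \<longleftrightarrow> (\<exists>p. length p = Suc m \<and> p!0 = u \<and> p!m = v \<and> set p \<subseteq> V \<and>
      (\<forall>i<m. adj (p!i) (p!Suc i)))"

text \<open>Graph distance (infinite if no walk exists).\<close>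
definition gdist :: "'v set \<Rightarrow> ('v \<Rightarrow> 'v \<Rightarrow> bool) \<Rightarrow> 'v \<Rightarrow> 'v \<Rightarrow> enat" where
  "gdist V adj u v = (INF m \<in> {m. is_walk V adj u v m}. enat m)"

definition packing_coloring :: "'v set \<Rightarrow> ('v \<Rightarrow> 'v \<Rightarrow> bool) \<Rightarrow> nat \<Rightarrow> ('v \<Rightarrow> nat) \<Rightarrow> bool" where
  "packing_coloring V adj c f \<longleftrightarrow> (\<forall>u\<in>V. f u \<in> {1..c}) \<and>
     (\<forall>u\<in>V. \<forall>v\<in>V. u \<noteq> v \<and> f u = f v \<longrightarrow> gdist V adj u v > enat (f u))"

definition packing_chromatic_number :: "'v set \<Rightarrow> ('v \<Rightarrow> 'v \<Rightarrow> bool) \<Rightarrow> nat" where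
  "packing_chromatic_number V adj = (LEAST c. \<exists>f. packing_coloring V adj c f)"

end

theory Submission
  imports Defs
begin

text \<open>Upper bounds. Every edge changes the parity of the last letter, so words with an even last
letter get colour 1 and walks between two words of one other colour have even length. A walk of
length 2 between distinct words with odd last letters either stays in one copy of the path, changing
the last letter by 2, or passes through a vertex at which two copies are joined. For \<open>k = 3\<close> only the
second kind occurs and it flips the parity of the second to last letter, so that parity chooses
between the colours 2 and 3. For \<open>k \<ge> 4\<close> a word \<open>..acc\<close> with \<open>c\<close> odd gets colour 4 or 5 according to
the parity of \<open>a\<close> (4 if \<open>n = 2\<close>, when there is no \<open>a\<close>), and the other words with odd last letter get 2 or 3 according to its
residue modulo 4.

Lower bounds. A packing colouring restricts to every subtree, since distances in the subtree are
only larger. Subtrees with 4, 8 and 20 vertices have no packing colouring with 2, 3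
and 4 colours, respectively; they were found by deleting vertices as long as no colouring appears.\<close>

section \<open>Adjacency of reversed words and parity\<close>

definition nb :: "nat \<Rightarrow> nat \<Rightarrow> bool" where
  "nb a b \<longleftrightarrow> b = a + 1 \<or> a = b + 1"

text \<open>Adjacency of reversed words, without the bound \<open>k\<close> on the letters: words are reversed here so
that the colours are determined by the first letters.\<close>
definition redge :: "nat list \<Rightarrow> nat list \<Rightarrow> bool" where
  "redge u v \<longleftrightarrow> (\<exists>r a b w. nb a b \<and> u = replicate r b @ a # w \<and> v = replicate r a @ b # w)"

lemma sier_adj_imp_redge:
  assumes "sier_adj (path_adj k) k n u v"
  shows "redge (rev u) (rev v)"
proof -
  obtain i where i: "i < n" "\<forall>j<i. u!j = v!j" "path_adj k (u!i) (v!i)"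
      "\<forall>j. i < j \<and> j < n \<longrightarrow> u!j = v!i \<and> v!j = u!i"
    and len: "length u = n" "length v = n"
    using assms by (auto simp: sier_adj_def sier_vertices_def)
  define r where "r = n - Suc i"
  have "take i v = take i u"
    using i len by (intro nth_equalityI) auto
  moreover have "drop (Suc i) u = replicate r (v!i)" "drop (Suc i) v = replicate r (u!i)"
    using i len by (auto simp: r_def intro!: nth_equalityI)
  ultimately have "u = take i u @ u!i # replicate r (v!i)" "v = take i u @ v!i # replicate r (u!i)"
    using i(1) len by (metis id_take_nth_drop)+
  then have "rev u = replicate r (v!i) @ u!i # rev (take i u)"
      "rev v = replicate r (u!i) @ v!i # rev (take i u)"
    by (metis rev_append rev.simps(2) rev_replicate append_Cons append_Nil append_assoc)+
  moreover have "nb (u!i) (v!i)"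
    using i(3) by (auto simp: nb_def path_adj_def)
  ultimately show ?thesis
    unfolding redge_def by blast
qed

lemma redge_sym: "redge u v \<Longrightarrow> redge v u"
  unfolding redge_def nb_def by blast

lemma redge_parity:
  assumes "redge u v"
  shows "even (hd u) \<longleftrightarrow> odd (hd v)"
proof -
  obtain r a b w where "nb a b" "u = replicate r b @ a # w" "v = replicate r a @ b # w"
    using assms by (auto simp: redge_def)
  then show ?thesis by (cases r) (auto simp: nb_def)
qed

lemma relpowp_redge_parity:
  "(redge ^^ l) u v \<Longrightarrow> (even (hd u) \<longleftrightarrow> even (hd v)) \<longleftrightarrow> even l"
proof (induction l arbitrary: v)
  case (Suc l)
  then obtain m where "(redge ^^ l) u m" "redge m v" by auto
  then show ?case using Suc.IH[of m] redge_parity[of m v] by auto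
qed auto

section \<open>Walks of length 2\<close>

lemma replicate_run_unique:
  assumes "replicate r a @ b # w = replicate s a @ c # x" "b \<noteq> a" "c \<noteq> a"
  shows "r = s \<and> b = c \<and> w = x"
  using assms
proof (induction r arbitrary: s)
  case 0
  then show ?case by (cases s) auto
next
  case (Suc r)
  then show ?case by (cases s) auto
qed

text \<open>The walks of length 2 consisting of an edge inside a copy of the path followed by an edge
between two copies; the middle vertex is \<open>replicate (Suc s) e @ j # w\<close>.\<close>
definition cross :: "nat list \<Rightarrow> nat list \<Rightarrow> bool" where
  "cross u v \<longleftrightarrow> (\<exists>s c e j w. nb c e \<and> nb e j \<and>
     u = c # replicate s e @ j # w \<and> v = j # replicate s j @ e # w)"

lemma redge_redge_cases:
  assumes "redge u m" "redge m v" "u \<noteq> v"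
  shows "(\<exists>c d w. u = c # w \<and> v = d # w \<and> (d = c + 2 \<or> c = d + 2)) \<or> cross u v \<or> cross v u"
proof -
  obtain r a b w where 1: "nb a b" "u = replicate r b @ a # w" "m = replicate r a @ b # w"
    using assms by (auto simp: redge_def)
  obtain r' a' b' w' where 2: "nb a' b'" "m = replicate r' b' @ a' # w'" "v = replicate r' a' @ b' # w'"
    using assms by (auto simp: redge_def)
  consider (in_in) "r = 0" "r' = 0" | (in_out) s where "r = 0" "r' = Suc s"
    | (out_in) s where "r = Suc s" "r' = 0" | (out_out) s s' where "r = Suc s" "r' = Suc s'"
    by (cases r; cases r')
  then show ?thesis
  proof cases
    case in_in
    then show ?thesis using 1 2 \<open>u \<noteq> v\<close> by (auto simp: nb_def)
  next
    case in_out
    then have "cross u v"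
      using 1 2 unfolding cross_def 
      by (intro exI[of _ s] exI[of _ a] exI[of _ b] exI[of _ a'] exI[of _ w']) (auto simp: nb_def)
    then show ?thesis by simp
  next
    case out_in
    then have "cross v u"
      using 1 2 unfolding cross_def 
      by (intro exI[of _ s] exI[of _ b'] exI[of _ a] exI[of _ b] exI[of _ w]) (auto simp: nb_def)
    then show ?thesis by simp
  next
    case out_out
    \<comment> \<open>Each vertex has at most one edge leaving its copy of the path, because its
      leading run and the letter after it determine that edge; so the second edge retraces the
      first.\<close>
    have "a = b'" using 1 2 out_out by auto
    with replicate_run_unique[of r a b w r' a' w'] 1 2 have "r = r' \<and> b = a' \<and> w = w'"
      by (auto simp: nb_def)
    then have False using 1 2 \<open>u \<noteq> v\<close> \<open>a = b'\<close> by simp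
    then show ?thesis ..
  qed
qed

section \<open>The two colourings along short walks\<close>

fun colour3 :: "nat list \<Rightarrow> nat" where
  "colour3 (c # d # w) = (if even c then 1 else if even d then 2 else 3)"
| "colour3 _ = 0"

fun colour5 :: "nat list \<Rightarrow> nat" where
  "colour5 (c # d # w) =
     (if even c then 1
      else if c = d then (if w = [] \<or> even (hd w) then 4 else 5)
      else if c mod 4 = 1 then 2 else 3)"
| "colour5 _ = 0"

lemma mod4_shift: "odd (c::nat) \<Longrightarrow> c mod 4 = 1 \<longleftrightarrow> (c + 2) mod 4 \<noteq> 1"
  by presburger

lemma nb_nb: "nb c e \<Longrightarrow> nb e j \<Longrightarrow> c = j \<or> c = j + 2 \<or> j = c + 2"
  by (auto simp: nb_def)

lemma nb_odd: "nb c e \<Longrightarrow> odd c \<longleftrightarrow> even e" "nb c e \<Longrightarrow> even c \<longleftrightarrow> odd e"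
  by (auto simp: nb_def)

lemma colour3_cross:
  assumes "cross u v" "odd (hd u)"
  shows "colour3 u \<noteq> colour3 v"
proof -
  obtain s c e j w where "nb c e" "nb e j" "u = c # replicate s e @ j # w" "v = j # replicate s j @ e # w"
    using assms(1) by (auto simp: cross_def)
  with assms(2) show ?thesis by (cases s) (auto simp: nb_odd)
qed

text \<open>For \<open>s > 0\<close>, and for \<open>s = 0\<close> with \<open>c = j\<close>,
  exactly one of the two words starts with a doubled letter. For \<open>s = 0\<close> with
  \<open>c \<noteq> j\<close> neither does, and \<open>c\<close> and \<open>j\<close> are odd
  letters differing by 2, so the residues modulo 4 separate them.\<close>

lemma colour5_cross:
  assumes "cross u v" "odd (hd u)"
  shows "colour5 u \<noteq> colour5 v"
proof -
  obtain s c e j w where *: "nb c e" "nb e j" "u = c # replicate s e @ j # w" "v = j # replicate s j @ e # w"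
    using assms(1) by (auto simp: cross_def)
  with assms(2) have "odd j" "even e" "odd c" by (auto simp: nb_odd)
  with * nb_nb[of c e j] mod4_shift[of c] mod4_shift[of j] show ?thesis by (cases s) auto
qed

lemma cross_odd: "cross u v \<Longrightarrow> odd (hd u) \<longleftrightarrow> odd (hd v)"
  by (auto simp: cross_def nb_def)

lemma colour5_two_steps:
  assumes "redge u m" "redge m v" "u \<noteq> v" "odd (hd u)" "length u \<ge> 2"
  shows "colour5 u \<noteq> colour5 v"
  using redge_redge_cases[OF assms(1-3)]
proof (elim disjE exE conjE)
  fix c d w assume "u = c # w" "v = d # w" "d = c + 2"
  then show ?thesis using assms mod4_shift[of c] by (cases w) auto
next
  fix c d w assume "u = c # w" "v = d # w" "c = d + 2"
  then show ?thesis using assms mod4_shift[of d] by (cases w) auto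
next
  assume "cross u v" then show ?thesis using colour5_cross assms by blast
next
  assume "cross v u" then show ?thesis using colour5_cross[of v u] cross_odd[of v u] assms by auto
qed

text \<open>Lists the possible midpoints of a walk of length 4 that starts at a word of colour 4 or
  5.\<close>

lemma two_steps_from_double:
  assumes "redge (c # c # t) m" "redge m x" "c # c # t \<noteq> x" "odd c"
  obtains (slide) d where "x = d # c # t"
  | (hook) e where "even e" "x = c # e # t"
  | (unhook) d e s w where "even e" "x = d # replicate (Suc s) e @ c # w"
      "c # c # t = replicate (Suc (Suc s)) c @ e # w"
  using redge_redge_cases[OF assms(1-3)]
proof (elim disjE exE conjE)
  assume "cross (c # c # t) x"
  then obtain s e j w where *: "nb c e" "nb e j" "c # t = replicate s e @ j # w"
      "x = j # replicate s j @ e # w"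
    by (auto simp: cross_def)
  with \<open>odd c\<close> have "even e" by (simp add: nb_odd)
  \<comment> \<open>A nonempty run of the even letter \<open>e\<close> cannot start with the odd
    letter \<open>c\<close>.\<close>
  then have "s = 0" using * \<open>odd c\<close> by (cases s) auto
  then show ?thesis using * \<open>even e\<close> by (intro hook[of e]) auto
next
  assume "cross x (c # c # t)"
  then obtain s d e w where *: "nb d e" "nb e c" "x = d # replicate s e @ c # w"
      "c # t = replicate s c @ e # w"
    by (auto simp: cross_def)
  with \<open>odd c\<close> have "even e" by (simp add: nb_odd)
  \<comment> \<open>With \<open>s = 0\<close> the odd letter \<open>c\<close> would equal the even
    letter \<open>e\<close>.\<close>
  then obtain s' where "s = Suc s'"
    using * \<open>odd c\<close> by (cases s) auto
  then show ?thesis using * \<open>even e\<close> by (intro unhook[of e d s' w]) auto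
next
  fix c' d w assume "c # c # t = c' # w" "x = d # w"
  then show ?thesis by (intro slide[of d]) auto
next
  fix c' d w assume "c # c # t = c' # w" "x = d # w"
  then show ?thesis by (intro slide[of d]) auto
qed

text \<open>The midpoint \<open>x\<close> has an odd second letter in case \<open>slide\<close> and
  an even one in the other two, and halves of the same kind lead back to the same end. There remains
  \<open>hook\<close> against \<open>unhook\<close>, where the third letters of the two ends have
  opposite parity, which separates colours 4 and 5.\<close>

lemma colour5_four_steps:
  assumes "redge (c # c # t) m" "redge m x" "redge x m'" "redge m' (d # d # t')"
    and "c # c # t \<noteq> d # d # t'" "c # c # t \<noteq> x" "x \<noteq> d # d # t'" "odd c" "odd d"
  shows "colour5 (c # c # t) \<noteq> colour5 (d # d # t')"
  using assms(1,2,6,8)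
proof (cases rule: two_steps_from_double)
  case slide
  from redge_sym[OF assms(4)] redge_sym[OF assms(3)] not_sym[OF assms(7)] assms(9) show ?thesis
    by (cases rule: two_steps_from_double) (use slide assms in auto)
next
  case (hook e)
  from redge_sym[OF assms(4)] redge_sym[OF assms(3)] not_sym[OF assms(7)] assms(9) show ?thesis
  proof (cases rule: two_steps_from_double)
    case (unhook d' e' s w)
    \<comment> \<open>Here \<open>t = replicate s e' @ d # w\<close> and
      \<open>t' = replicate s d @ e' # w\<close>, with \<open>d\<close> odd and \<open>e'\<close>
      even, so their heads differ in parity for every \<open>s\<close>.\<close>
    then show ?thesis using hook assms by (cases s) auto
  qed (use hook assms in auto)
next
  case (unhook c' e s w)
  note u = this
  from redge_sym[OF assms(4)] redge_sym[OF assms(3)] not_sym[OF assms(7)] assms(9) show ?thesis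
  proof (cases rule: two_steps_from_double)
    case slide
    then show ?thesis using unhook assms by auto
  next
    case (hook e')
    then show ?thesis using unhook assms by (cases s) auto
  next
    case (unhook d' e' s' w')
    then have "e' = e" using u by auto
    moreover have "s = s' \<and> c = d \<and> w = w'"
      using replicate_run_unique[of "Suc s" e c w "Suc s'" d w'] u unhook \<open>e' = e\<close> assms by auto
    ultimately show ?thesis using u unhook assms by simp
  qed
qed

section \<open>Upper bounds\<close>

lemma gdist_greater:
  assumes "\<And>m. m \<le> c \<Longrightarrow> \<not> is_walk V adj u v m"
  shows "gdist V adj u v > enat c"
proof -
  have "enat (Suc c) \<le> gdist V adj u v"
    unfolding gdist_def using assms by (intro INF_greatest) (auto simp: not_less_eq_eq[symmetric])
  then show ?thesis
    by (meson enat_ord_simps(2) lessI less_le_trans)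
qed

lemma gdist_le: "is_walk V adj u v m \<Longrightarrow> gdist V adj u v \<le> enat m"
  unfolding gdist_def by (intro INF_lower) auto

lemma is_walk_relpowp: "is_walk V adj u v m \<Longrightarrow> (adj ^^ m) u v"
  unfolding is_walk_def relpowp_fun_conv by blast

lemma relpowp_redge:
  "(sier_adj (path_adj k) k n ^^ l) u v \<Longrightarrow> (redge ^^ l) (rev u) (rev v)"
  by (induction l arbitrary: v) (auto dest: sier_adj_imp_redge)

text \<open>Passing to \<open>redge\<close> forgets the bound on the letters and can only add walks,
  so excluding short walks of \<open>redge\<close> suffices.\<close>

lemma packing_coloring_rev:
  assumes "\<And>u. u \<in> sier_vertices k n \<Longrightarrow> g (rev u) \<in> {1..c}"
    and "\<And>u v l. u \<in> sier_vertices k n \<Longrightarrow> v \<in> sier_vertices k n \<Longrightarrow> g (rev u) = g (rev v) \<Longrightarrow>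
           (redge ^^ l) (rev u) (rev v) \<Longrightarrow> l \<le> g (rev u) \<Longrightarrow> u = v"
  shows "packing_coloring (sier_vertices k n) (sier_adj (path_adj k) k n) c (g \<circ> rev)"
  unfolding packing_coloring_def
  using assms by (auto intro!: gdist_greater dest!: is_walk_relpowp relpowp_redge)

lemma relpowp_2: "(R ^^ 2) x z \<longleftrightarrow> (\<exists>y. R x y \<and> R y z)"
  by (auto simp: numeral_2_eq_2)

lemma relpowp_4: "(R ^^ 4) x z \<longleftrightarrow> (\<exists>a b c. R x a \<and> R a b \<and> R b c \<and> R c z)"
  by (auto simp: numeral_eq_Suc relcompp_apply)

lemma two_letters: "length u \<ge> 2 \<Longrightarrow> \<exists>c d w. u = c # d # w"
  by (cases u; cases "tl u") auto

lemma colour3_packing: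
  assumes "n \<ge> 2"
  shows "packing_coloring (sier_vertices 3 n) (sier_adj (path_adj 3) 3 n) 3 (colour3 \<circ> rev)"
proof (rule packing_coloring_rev)
  have ends: "\<exists>c d w. rev u = c # d # w \<and> c < 3" if "u \<in> sier_vertices 3 n" for u
  proof -
    have "length (rev u) \<ge> 2" "set (rev u) \<subseteq> {..<3}"
      using that assms by (auto simp: sier_vertices_def)
    then show ?thesis using two_letters[of "rev u"] by auto
  qed
  show "colour3 (rev u) \<in> {1..3}" if "u \<in> sier_vertices 3 n" for u
    using ends[OF that] by auto
  fix u v l
  assume V: "u \<in> sier_vertices 3 n" "v \<in> sier_vertices 3 n"
    and same: "colour3 (rev u) = colour3 (rev v)"
    and walk: "(redge ^^ l) (rev u) (rev v)" "l \<le> colour3 (rev u)"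
  obtain c d w where u: "rev u = c # d # w" "c < 3" using ends V by blast
  obtain c' d' w' where v: "rev v = c' # d' # w'" "c' < 3" using ends V by blast
  have parity: "even c \<longleftrightarrow> even c'"
    using same u v by (auto split: if_splits)
  then have "even l" using relpowp_redge_parity[OF walk(1)] u v by simp
  show "u = v"
  proof (cases "l = 0")
    case True
    then show ?thesis using walk by simp
  next
    case False
    have "l \<le> (if even c then 1 else 3)" using walk(2) u by (auto split: if_splits)
    then have "odd c" "l = 2" using False \<open>even l\<close> by (auto split: if_splits elim!: evenE)
    then obtain m where m: "redge (rev u) m" "redge m (rev v)"
      using walk(1) relpowp_2 by metis
    show ?thesis
    proof (rule ccontr)
      assume "u \<noteq> v"
      then have "rev u \<noteq> rev v" by simp
      \<comment> \<open>The first case is impossible, since 1 is the only odd letter below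
        3.\<close>
      from redge_redge_cases[OF m this] consider "c = c' + 2 \<or> c' = c + 2"
        | "cross (rev u) (rev v)" | "cross (rev v) (rev u)" using u v by auto
      then show False
        using colour3_cross[of "rev u" "rev v"] colour3_cross[of "rev v" "rev u"]
          same u v \<open>odd c\<close> parity by cases auto
    qed
  qed
qed

lemma colour5_packing:
  assumes "n \<ge> 2"
  shows "packing_coloring (sier_vertices k n) (sier_adj (path_adj k) k n)
           (if n = 2 then 4 else 5) (colour5 \<circ> rev)"
proof (rule packing_coloring_rev)
  have ends: "\<exists>c d w. rev u = c # d # w \<and> n = length w + 2" if "u \<in> sier_vertices k n" for u
  proof -
    have "length (rev u) \<ge> 2" "length (rev u) = n"
      using that assms by (auto simp: sier_vertices_def)
    then show ?thesis using two_letters[of "rev u"] by auto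
  qed
  \<comment> \<open>For \<open>n = 2\<close> the rest \<open>w\<close> is empty, so colour 5 does
    not occur.\<close>
  show "colour5 (rev u) \<in> {1..if n = 2 then 4 else 5}" if "u \<in> sier_vertices k n" for u
    using ends[OF that] by auto
  fix u v l
  assume V: "u \<in> sier_vertices k n" "v \<in> sier_vertices k n"
    and same: "colour5 (rev u) = colour5 (rev v)"
    and walk: "(redge ^^ l) (rev u) (rev v)" "l \<le> colour5 (rev u)"
  obtain c d w where u: "rev u = c # d # w" using ends V by blast
  obtain c' d' w' where v: "rev v = c' # d' # w'" using ends V by blast
  have parity: "even c \<longleftrightarrow> even c'"
    using same u v by (auto split: if_splits)
  then have "even l" using relpowp_redge_parity[OF walk(1)] u v by simp
  have bound: "l \<le> (if even c then 1 else if c = d then 5 else 3)"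
    using walk(2) u by (auto split: if_splits)
  show "u = v"
  proof (cases "l = 0")
    case True
    then show ?thesis using walk by simp
  next
    case False
    then have "odd c" using bound \<open>even l\<close> by (auto split: if_splits elim!: evenE)
    have no_two: "u = v" if "redge (rev u) m" "redge m (rev v)" for m
    proof (rule ccontr)
      assume "u \<noteq> v"
      moreover have "odd (hd (rev u))" "length (rev u) \<ge> 2" using u \<open>odd c\<close> by simp_all
      ultimately show False using colour5_two_steps[OF that] same by simp
    qed
    have "l = 2 \<or> (l = 4 \<and> c = d)"
      using False bound \<open>even l\<close> \<open>odd c\<close> by (auto split: if_splits elim!: evenE)
    then show ?thesis
    proof (elim disjE conjE)
      assume "l = 2"
      then show ?thesis using walk(1) no_two relpowp_2 by metis
    next
      assume "l = 4" "c = d"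
      then obtain m x m' where m: "redge (rev u) m" "redge m x" "redge x m'" "redge m' (rev v)"
        using walk(1) relpowp_4[of redge] by blast
      have "c' = d'"
        using same u v \<open>c = d\<close> \<open>odd c\<close> parity by (auto split: if_splits)
      \<comment> \<open>If the midpoint \<open>x\<close> is one of the ends, the other half is a
        walk of length 2 between both ends and \<open>no_two\<close> applies.\<close>
      then show ?thesis
        using no_two m colour5_four_steps[of c w m x m' c' w'] u v same \<open>c = d\<close> \<open>odd c\<close> parity
        by (metis rev_rev_ident)
    qed
  qed
qed

section \<open>Lower bounds by backtracking on trees\<close>

lemma is_walk_Nil: "u \<in> V \<Longrightarrow> is_walk V adj u u 0"
  unfolding is_walk_def by (intro exI[of _ "[u]"]) auto

lemma is_walk_Cons:
  assumes "is_walk V adj w v m" "u \<in> V" "adj u w"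
  shows "is_walk V adj u v (Suc m)"
proof -
  obtain p where "length p = Suc m" "p!0 = w" "p!m = v" "set p \<subseteq> V" "\<forall>i<m. adj (p!i) (p!Suc i)"
    using assms(1) by (auto simp: is_walk_def)
  then show ?thesis
    unfolding is_walk_def using assms
    by (intro exI[of _ "u # p"]) (auto simp: less_Suc_eq_0_disj)
qed

lemma is_walk_snoc:
  assumes "is_walk V adj u w m" "v \<in> V" "adj w v"
  shows "is_walk V adj u v (Suc m)"
proof -
  obtain p where "length p = Suc m" "p!0 = u" "p!m = w" "set p \<subseteq> V" "\<forall>i<m. adj (p!i) (p!Suc i)"
    using assms(1) by (auto simp: is_walk_def)
  then show ?thesis
    unfolding is_walk_def using assms
    by (intro exI[of _ "p @ [v]"]) (auto simp: nth_append less_Suc_eq)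
qed

text \<open>A tree on \<open>{0..<length q}\<close> with root 0 in which the parent of \<open>i > 0\<close> is \<open>i - Suc (q ! i)\<close>. Storing
the offset rather than the parent makes the recursion terminate for every \<open>q\<close>; the entry \<open>q ! 0\<close>
is irrelevant.\<close>
fun tree_dist :: "nat list \<Rightarrow> nat \<Rightarrow> nat \<Rightarrow> nat" where
  "tree_dist q i j =
     (if i = j then 0
      else if j < i then Suc (tree_dist q (i - Suc (q ! i)) j)
      else Suc (tree_dist q i (j - Suc (q ! j))))"

declare tree_dist.simps [simp del]

definition dist_rows :: "nat list \<Rightarrow> nat list list" where
  "dist_rows q = map (\<lambda>i. map (tree_dist q i) [0..<i]) [0..<length q]"

text \<open>Backtracking search: \<open>cs\<close> lists the colours of the vertices treated so far, and each row the
distances from the next vertex to those. The conditional instead of a conjunction lets the simplifier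
prune the search.\<close>
fun extendable :: "nat \<Rightarrow> nat list list \<Rightarrow> nat list \<Rightarrow> bool" where
  "extendable c [] cs = True"
| "extendable c (r # rs) cs =
     list_ex (\<lambda>x. if list_all2 (\<lambda>d y. y = x \<longrightarrow> x < d) r cs
                   then extendable c rs (cs @ [x]) else False) [1..<Suc c]"

text \<open>The recursion replaces the larger vertex by its parent, so the walk grows at the front
  or at the back accordingly.\<close>

lemma is_walk_tree_dist:
  assumes "\<And>i. i < N \<Longrightarrow> g i \<in> V"
    and "\<And>i. 0 < i \<Longrightarrow> i < N \<Longrightarrow> adj (g i) (g (i - Suc (q ! i))) \<and> adj (g (i - Suc (q ! i))) (g i)"
    and "i < N" "j < N"
  shows "is_walk V adj (g i) (g j) (tree_dist q i j)"
  using assms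
proof (induction q i j rule: tree_dist.induct)
  case (1 q i j)
  consider "i = j" | "j < i" | "i < j" by linarith
  then show ?case
  proof cases
    case 1
    then show ?thesis using "1.prems" by (simp add: is_walk_Nil tree_dist.simps)
  next
    case 2
    then have "is_walk V adj (g (i - Suc (q ! i))) (g j) (tree_dist q (i - Suc (q ! i)) j)"
      using "1.prems" by (intro "1.IH"(1)) auto
    then show ?thesis
      using 2 "1.prems" by (simp add: tree_dist.simps[of q i j] is_walk_Cons)
  next
    case 3
    then have "is_walk V adj (g i) (g (j - Suc (q ! j))) (tree_dist q i (j - Suc (q ! j)))"
      using "1.prems" by (intro "1.IH"(2)) auto
    then show ?thesis
      using 3 "1.prems" by (simp add: tree_dist.simps[of q i j] is_walk_snoc)
  qed
qed

text \<open>A search that follows the colours \<open>f (g i)\<close> never gets stuck: walks in the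
  tree bound the graph distances from above.\<close>

lemma extendable_of_packing_coloring:
  assumes "packing_coloring V adj c f"
    and V: "\<And>i. i < length q \<Longrightarrow> g i \<in> V"
    and tree: "\<And>i. 0 < i \<Longrightarrow> i < length q \<Longrightarrow>
      adj (g i) (g (i - Suc (q ! i))) \<and> adj (g (i - Suc (q ! i))) (g i)"
    and inj: "inj_on g {..<length q}"
  shows "extendable c (dist_rows q) []"
proof -
  \<comment> \<open>Downward induction, from all vertices coloured to none; the case
    \<open>m = 0\<close> is the claim.\<close>
  have "extendable c (map (\<lambda>i. map (tree_dist q i) [0..<i]) [m..<length q]) (map (f \<circ> g) [0..<m])"
    if "m \<le> length q" for m
    using that
  proof (induction m rule: inc_induct)
    case base
    then show ?case by simp
  next
    case (step m)
    have "f (g m) < tree_dist q m j" if "j < m" "f (g j) = f (g m)" for j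
    proof -
      have "g m \<noteq> g j"
        using inj_onD[OF inj, of m j] that step by auto
      then have "enat (f (g m)) < gdist V adj (g m) (g j)"
        using assms(1) V[of m] V[of j] step that unfolding packing_coloring_def by force
      also have "\<dots> \<le> enat (tree_dist q m j)"
        using step that by (intro gdist_le is_walk_tree_dist[of "length q"] V tree) auto
      finally show ?thesis by simp
    qed
    then have "list_all2 (\<lambda>d y. y = f (g m) \<longrightarrow> f (g m) < d)
        (map (tree_dist q m) [0..<m]) (map (f \<circ> g) [0..<m])"
      by (auto simp: list_all2_conv_all_nth)
    moreover have "f (g m) \<in> set [1..<Suc c]"
      using assms(1) V step by (force simp: packing_coloring_def)
    moreover have "extendable c (map (\<lambda>i. map (tree_dist q i) [0..<i]) [Suc m..<length q])
        (map (f \<circ> g) [0..<m] @ [f (g m)])"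
      using step.IH by (simp add: comp_def)
    moreover have "[m..<length q] = m # [Suc m..<length q]"
      using step.hyps by (simp add: upt_conv_Cons)
    ultimately show ?case
      by (simp only: list.map extendable.simps list_ex_iff if_True) (rule bexI[of _ "f (g m)"]; simp)
  qed
  from this[of 0] show ?thesis by (simp add: dist_rows_def)
qed

section \<open>Trees in Sierpinski graphs\<close>

fun word_adj :: "nat list \<Rightarrow> nat list \<Rightarrow> bool" where
  "word_adj (x # u) (y # v) =
     (if x = y then word_adj u v
      else (y = Suc x \<or> x = Suc y) \<and> length u = length v \<and>
           list_all (\<lambda>z. z = y) u \<and> list_all (\<lambda>z. z = x) v)"
| "word_adj _ _ = False"

text \<open>Lets edges be checked by evaluation: \<open>word_adj\<close> finds the position
  \<open>i\<close> of \<open>sier_adj\<close> by recursion instead of an existential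
  quantifier.\<close>

lemma sier_adj_of_word_adj:
  assumes "word_adj u v" "set u \<subseteq> {..<k}" "set v \<subseteq> {..<k}"
  shows "sier_adj (path_adj k) k (length u) u v"
  using assms
proof (induction u v rule: word_adj.induct)
  case (1 x u y v)
  show ?case
  proof (cases "x = y")
    case True
    then have "sier_adj (path_adj k) k (length u) u v" using 1 by auto
    then obtain i where "i < length u" "length v = length u" "\<forall>j<i. u!j = v!j" "u!i \<noteq> v!i"
        "path_adj k (u!i) (v!i)" "\<forall>j. i < j \<and> j < length u \<longrightarrow> u!j = v!i \<and> v!j = u!i"
      by (auto simp: sier_adj_def sier_vertices_def)
    then show ?thesis using 1(3,4) \<open>x = y\<close>
      unfolding sier_adj_def sier_vertices_def
      by (auto intro!: exI[of _ "Suc i"] simp: nth_Cons split: nat.split)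
  next
    case False
    then show ?thesis using 1(2-4)
      unfolding sier_adj_def sier_vertices_def
      by (auto intro!: exI[of _ 0] simp: path_adj_def list_all_length nth_Cons split: nat.split)
  qed
qed auto

lemma word_adj_append: "word_adj (w @ u) (w @ v) \<longleftrightarrow> word_adj u v"
  by (induction w) auto

definition sier_tree :: "nat \<Rightarrow> nat \<Rightarrow> nat list \<Rightarrow> nat list list \<Rightarrow> bool" where
  "sier_tree k n q us \<longleftrightarrow> length us = length q \<and> distinct us \<and>
     list_all (\<lambda>u. length u = n \<and> list_all (\<lambda>x. x < k) u) us \<and>
     list_all (\<lambda>i. word_adj (us ! i) (us ! (i - Suc (q ! i))) \<and>
                   word_adj (us ! (i - Suc (q ! i))) (us ! i)) [1..<length q]"

text \<open>One tree serves all larger \<open>k\<close> and \<open>n\<close>, because a common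
  prefix of zeros preserves adjacency and distinctness.\<close>

lemma no_packing_coloring:
  assumes tree: "sier_tree k\<^sub>0 n\<^sub>0 q us" and "\<not> extendable c (dist_rows q) []"
    and le: "k\<^sub>0 \<le> k" "n\<^sub>0 \<le> n" "0 < k"
  shows "\<not> packing_coloring (sier_vertices k n) (sier_adj (path_adj k) k n) c f"
proof
  assume f: "packing_coloring (sier_vertices k n) (sier_adj (path_adj k) k n) c f"
  define g where "g i = replicate (n - n\<^sub>0) 0 @ us ! i" for i
  have len: "length us = length q" using tree by (simp add: sier_tree_def)
  have V: "g i \<in> sier_vertices k n" if "i < length q" for i
  proof -
    have "us ! i \<in> set us" using that len by simp
    then have "length (us ! i) = n\<^sub>0" "set (us ! i) \<subseteq> {..<k\<^sub>0}"
      using tree by (auto simp: sier_tree_def list_all_iff)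
    then show ?thesis using le by (auto simp: g_def sier_vertices_def)
  qed
  have adj: "sier_adj (path_adj k) k n (g i) (g j)"
    if "word_adj (us ! i) (us ! j)" "i < length q" "j < length q" for i j
    using sier_adj_of_word_adj[of "g i" "g j" k] V[of i] V[of j] that
    by (auto simp: g_def word_adj_append sier_vertices_def)
  have "extendable c (dist_rows q) []"
  proof (rule extendable_of_packing_coloring[OF f V])
    show "sier_adj (path_adj k) k n (g i) (g (i - Suc (q ! i))) \<and>
        sier_adj (path_adj k) k n (g (i - Suc (q ! i))) (g i)" if "0 < i" "i < length q" for i
      using tree that by (intro conjI adj) (auto simp: sier_tree_def list_all_iff)
    show "inj_on g {..<length q}"
      using tree by (auto simp: sier_tree_def g_def inj_on_def nth_eq_iff_index_eq)
  qed
  with assms(2) show False ..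
qed

section \<open>The values of the packing chromatic number\<close>

lemma packing_chromatic_number_eqI:
  assumes "packing_coloring V adj c f" "\<And>f. \<not> packing_coloring V adj b f" "c = Suc b"
  shows "packing_chromatic_number V adj = c"
  unfolding packing_chromatic_number_def
proof (rule Least_equality)
  show "\<exists>f. packing_coloring V adj c f" using assms(1) by blast
next
  fix y assume "\<exists>f. packing_coloring V adj y f"
  then obtain f where f: "packing_coloring V adj y f" ..
  show "c \<le> y"
  proof (rule ccontr)
    assume "\<not> c \<le> y"
    \<comment> \<open>A colouring with \<open>y \<le> b\<close> colours is also one with
      \<open>b\<close> colours.\<close>
    then have "packing_coloring V adj b f"
      using f \<open>c = Suc b\<close> by (force simp: packing_coloring_def)
    with assms(2) show False by blast
  qed
qed

lemma no_packing_2_coloring: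
  assumes "k \<ge> 3" "n \<ge> 2"
  shows "\<not> packing_coloring (sier_vertices k n) (sier_adj (path_adj k) k n) 2 f"
proof (rule no_packing_coloring)
  \<comment> \<open>A path on 4 vertices: only its two ends can share colour 2, and any choice for
    colour 2 leaves an edge inside colour 1.\<close>
  show "sier_tree 3 2 [0,0,0,0] [[0,0],[0,1],[1,0],[1,1]]" by code_simp
  show "\<not> extendable 2 (dist_rows [0,0,0,0]) []" by code_simp
qed (use assms in auto)

lemma no_packing_3_coloring:
  assumes "k \<ge> 4" "n \<ge> 2"
  shows "\<not> packing_coloring (sier_vertices k n) (sier_adj (path_adj k) k n) 3 f"
proof (rule no_packing_coloring)
  \<comment> \<open>The two copies of the path with first letters 1 and 2, joined by the edge
    between 12 and 21.\<close>
  show "sier_tree 4 2 [0,0,0,1,0,1,5,1] 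
      [[2,2],[2,1],[2,0],[1,2],[1,3],[1,1],[2,3],[1,0]]" by code_simp
  show "\<not> extendable 3 (dist_rows [0,0,0,1,0,1,5,1]) []" by code_simp
qed (use assms in auto)

lemma no_packing_4_coloring:
  assumes "k \<ge> 4" "n \<ge> 3"
  shows "\<not> packing_coloring (sier_vertices k n) (sier_adj (path_adj k) k n) 4 f"
proof (rule no_packing_coloring)
  \<comment> \<open>Symmetric about the edge between 122 and 211: the whole copies 12 and 21, and
    the copies 11, 13, 20 and 22 without the ends 110, 130, 203 and 223.\<close>
  show "sier_tree 4 3 [0,0,0,1,0,1,5,6,0,1,1,2,0,1,7,0,1,7,0,1]
      [[1,2,2],[1,2,1],[1,2,0],[1,1,2],[1,1,1],[1,1,3],[1,2,3],[2,1,1],[2,1,2],[2,1,0],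
       [2,1,3],[2,2,1],[2,2,2],[2,2,0],[1,3,2],[1,3,3],[1,3,1],[2,0,1],[2,0,0],[2,0,2]]"
    by code_simp
  show "\<not> extendable 4 (dist_rows [0,0,0,1,0,1,5,6,0,1,1,2,0,1,7,0,1,7,0,1]) []"
    by code_simp
qed (use assms in auto)

theorem theorem3:
  fixes k n :: nat
  assumes "k \<ge> 3" and "n \<ge> 2"
  shows "packing_chromatic_number (sier_vertices k n) (sier_adj (path_adj k) k n) =
           (if k = 3 then 3 else if n = 2 then 4 else 5)"
proof -
  consider "k = 3" | "k \<ge> 4" "n = 2" | "k \<ge> 4" "n \<ge> 3"
    using assms by linarith
  then show ?thesis
  proof cases
    case 1
    have "packing_chromatic_number (sier_vertices 3 n) (sier_adj (path_adj 3) 3 n) = 3"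
      by (rule packing_chromatic_number_eqI[OF colour3_packing no_packing_2_coloring])
        (use assms in simp_all)
    then show ?thesis using 1 by simp
  next
    case 2
    have "packing_chromatic_number (sier_vertices k n) (sier_adj (path_adj k) k n) =
        (if n = 2 then 4 else 5)"
      by (rule packing_chromatic_number_eqI[OF colour5_packing no_packing_3_coloring])
        (use 2 in simp_all)
    then show ?thesis using 2 by simp
  next
    case 3
    have "packing_chromatic_number (sier_vertices k n) (sier_adj (path_adj k) k n) =
        (if n = 2 then 4 else 5)"
      by (rule packing_chromatic_number_eqI[OF colour5_packing no_packing_4_coloring])
        (use 3 in simp_all)
    then show ?thesis using 3 by simp
  qed
qed

end
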